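(* Let $\kappa:\mathbb{R}_0^+\to\mathbb{R}_0^+$ satisfy Assumption (K) of the context with constants $c_1>0$ and $L_1>0$, let $m\in\mathbb{R}_0^+$, $T>0$, $N\in\mathbb{N}$, $N\ge 1$, and let $b_1^{(k)},\dots,b_N^{(k)}\in\mathbb{R}$, $z\in\mathbb{R}$, the Jacobian $\mathbf{J}_{\mathbf{R}}^{k}(\mathbf{U})\in\mathbb{R}^{N\times N}$, and the starting point $\mathbf{U}^{(0)}\in\mathbb{R}^N$ be as in the context. Let $D\subset\mathbb{R}^N$ be open and convex with $\mathbf{U}^{(0)}\in D$. Let $L_2$ be a Lipschitz constant of $\kappa_{\mathrm{d}}$, i.e. $|\kappa_{\mathrm{d}}(x)-\kappa_{\mathrm{d}}(y)|\le L_2|x-y|$ for all $x,y\in\mathbb{R}$ (for example $L_2=\sup_{t\in\mathbb{R}_0^+}|\kappa'(t)|+L_1$), and put $\delta_0=L_2/c_1$. Then $\mathbf{J}_{\mathbf{R}}^{k}(\mathbf{U}^{(0)})$ is invertible and the affine covariant Lipschitz condition $$\left\|\mathbf{J}_{\mathbf{R}}^{k}\bigl(\mathbf{U}^{(0)}\bigr)^{-1}\left[\mathbf{J}_{\mathbf{R}}^{k}(\mathbf{U})-\mathbf{J}_{\mathbf{R}}^{k}\bigl(\mathbf{U}^{(0)}\bigr)\right]\right\|_2\le \delta_0\,\bigl\|\mathbf{U}-\mathbf{U}^{(0)}\bigr\|_2$$ holds for all $\mathbf{U}\in D$, where $\|\cdot\|_2$ denotes the spectral norm (largest singular value) for matrices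 and the Euclidean norm for vectors.
   Context: Notation: $\mathbb{R}_0^+=[0,\infty)$. Assumption (K) on $\kappa:\mathbb{R}_0^+\to\mathbb{R}_0^+$: (i) $\kappa(t)\ge c_1>0$ for all $t\in\mathbb{R}_0^+$; (ii) $f(t):=\kappa(t)t$ is strongly monotone with constant $c_1$: $(f(t)-f(s))(t-s)\ge c_1(t-s)^2$ for all $t,s\in\mathbb{R}_0^+$; (iii) $\kappa\in C^1(\mathbb{R}_0^+)$ (with the one-sided derivative at $0$) and $\lim_{t\to\infty}\kappa'(t)=0$; (iv) $g(t):=\kappa'(t)t$ is Lipschitz continuous: there is $L_1>0$ with $|g(t)-g(s)|\le L_1|t-s|$ for all $t,s\in\mathbb{R}_0^+$. Define $\kappa_{\mathrm{d}}:\mathbb{R}\to\mathbb{R}_0^+$ by $\kappa_{\mathrm{d}}(x)=\kappa'(|x|)|x|+\kappa(|x|)$. Model problem: the time-periodic scalar ODE $m u'(t)+\kappa(|u|)u(t)=j(t)$ for $t\in(0,T)$, $u(0)=u(T)$, with given $T$-periodic input $j$. Let $\Delta T=T/N$, $T_n=n\Delta T$ for $n=0,\dots,N$, and $c=m/\Delta T$. In a periodic Parareal iteration with index $k$, the real numbers $b_n^{(k)}$, $n=1,\dots,N$, are the differences $b_n^{(k)}=\mathcal{F}(T_n,T_{n-1},U_{n-1}^{(k)})-\mathcal{G}(T_n,T_{n-1},U_{n-1}^{(k)})$, where $U_{n-1}^{(k)}$ are the current iterates and $\mathcal{F}$, $\mathcal{G}$ are the fine and coarse propagators (numerical solvers returning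 an approximation at $T_n$ of the ODE solution started at $T_{n-1}$ from the given value); for the present purpose they are simply given real numbers, fixed for the given $k$. For $\mathbf{U}=[u_0,\dots,u_{N-1}]^{\top}\in\mathbb{R}^N$, set $\beta_0:=b_N^{(k)}$ and $\beta_n:=b_n^{(k)}$ for $1\le n\le N-1$. The nonlinear system solved by the simplified Newton method is $\mathbf{R}^k(\mathbf{U})=\mathbf{0}$, where, with $u_{-1}:=u_{N-1}$, the component with index $n=0,\dots,N-1$ is $$\bigl(c+\kappa(|u_n-\beta_n|)\bigr)(u_n-\beta_n)-c\,u_{n-1}-j(T_n)$$ (with $j(T_0)=j(T_N)$). Its Jacobian $\mathbf{J}_{\mathbf{R}}^{k}(\mathbf{U})=\frac{\mathrm{d}}{\mathrm{d}\mathbf{U}}\mathbf{R}^k(\mathbf{U})\in\mathbb{R}^{N\times N}$ is the cyclic matrix with diagonal entries $c+\kappa_{\mathrm{d}}(u_n-\beta_n)$, $n=0,\dots,N-1$, entries $-c$ on the first subdiagonal and in the upper right corner, and zeros elsewhere; equivalently $\mathbf{J}_{\mathbf{R}}^{k}(\mathbf{U})=\mathrm{diag}\bigl(c+\kappa_{\mathrm{d}}(u_n-\beta_n)\bigr)_{n=0}^{N-1}-c\,\mathbf{P}$, where $\mathbf{P}$ is the cyclic shift $(\mathbf{P}\mathbf{U})_n=u_{n-1}$ (indices modulo $N$). For a fixed value $z\in\mathbb{R}$, the starting point is $\mathbf{U}^{(0)}=\bigl[z+b_N^{(k)},\,z+b_1^{(k)},\dots,z+b_{N-1}^{(k)}\bigr]^{\top}$,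 so that all diagonal entries of $\mathbf{J}_{\mathbf{R}}^{k}(\mathbf{U}^{(0)})$ equal $c+\kappa_{\mathrm{d}}(z)$. *)

theory Defs
  imports "HOL-Analysis.Analysis"
begin

text \<open>
  Assumption (K). The parameter \<open>\<kappa>'\<close> is the derivative of \<open>\<kappa>\<close> on the half line, one-sided at 0;
  it is determined by \<open>\<kappa>\<close> there. Values at negative arguments are irrelevant,
  and nonnegativity of \<open>\<kappa>\<close> is contained in \<open>\<kappa> t \<ge> c1 > 0\<close>.
\<close>

definition assumption_K :: "(real \<Rightarrow> real) \<Rightarrow> (real \<Rightarrow> real) \<Rightarrow> real \<Rightarrow> real \<Rightarrow> bool" where
  "assumption_K \<kappa> \<kappa>' c1 L1 \<longleftrightarrow>
     c1 > 0 \<and> (\<forall>t\<ge>0. \<kappa> t \<ge> c1) \<and>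
     (\<forall>t\<ge>0. \<forall>s\<ge>0. (\<kappa> t * t - \<kappa> s * s) * (t - s) \<ge> c1 * (t - s)\<^sup>2) \<and>
     (\<forall>t\<ge>0. (\<kappa> has_real_derivative \<kappa>' t) (at t within {0..})) \<and>
     continuous_on {0..} \<kappa>' \<and> (\<kappa>' \<longlongrightarrow> 0) at_top \<and>
     L1 > 0 \<and> L1-lipschitz_on {0..} (\<lambda>t. \<kappa>' t * t)"

definition kappa_d :: "(real \<Rightarrow> real) \<Rightarrow> (real \<Rightarrow> real) \<Rightarrow> real \<Rightarrow> real" where
  "kappa_d \<kappa> \<kappa>' x = \<kappa>' \<bar>x\<bar> * \<bar>x\<bar> + \<kappa> \<bar>x\<bar>"

text \<open>
  Vectors in \<open>\<real>\<^sup>N\<close> have type \<open>real ^ 'n\<close> with \<open>N = CARD('n)\<close>. A numbering \<open>\<iota>\<close>, a bijection from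
  \<open>'n\<close> onto \<open>{0..<N}\<close>, says which index \<open>n\<close> each coordinate carries; all definitions
  are relative to it.
\<close>

definition cyclic_pred :: "('n::finite \<Rightarrow> nat) \<Rightarrow> 'n \<Rightarrow> 'n" where
  "cyclic_pred \<iota> i = inv \<iota> (if \<iota> i = 0 then CARD('n) - 1 else \<iota> i - 1)"

definition shift_beta :: "('n::finite \<Rightarrow> nat) \<Rightarrow> (nat \<Rightarrow> real) \<Rightarrow> real ^ 'n" where
  "shift_beta \<iota> b = (\<chi> i. if \<iota> i = 0 then b CARD('n) else b (\<iota> i))"

definition parareal_residual ::
  "('n::finite \<Rightarrow> nat) \<Rightarrow> (real \<Rightarrow> real) \<Rightarrow> real \<Rightarrow> real \<Rightarrow> (real \<Rightarrow> real) \<Rightarrow> (nat \<Rightarrow> real)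
     \<Rightarrow> real ^ 'n \<Rightarrow> real ^ 'n" where
  "parareal_residual \<iota> \<kappa> m T j b U =
     (let \<Delta>T = T / real CARD('n); c = m / \<Delta>T; \<beta> = shift_beta \<iota> b in
      \<chi> i. (c + \<kappa> \<bar>U $ i - \<beta> $ i\<bar>) * (U $ i - \<beta> $ i) - c * U $ cyclic_pred \<iota> i - j (real (\<iota> i) * \<Delta>T))"

definition parareal_jacobian ::
  "('n::finite \<Rightarrow> nat) \<Rightarrow> (real \<Rightarrow> real) \<Rightarrow> real \<Rightarrow> real \<Rightarrow> (real \<Rightarrow> real) \<Rightarrow> (nat \<Rightarrow> real)
     \<Rightarrow> real ^ 'n \<Rightarrow> real ^ 'n ^ 'n" where
  "parareal_jacobian \<iota> \<kappa> m T j b U = jacobian (parareal_residual \<iota> \<kappa> m T j b) (at U)"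

definition starting_point :: "('n::finite \<Rightarrow> nat) \<Rightarrow> (nat \<Rightarrow> real) \<Rightarrow> real \<Rightarrow> real ^ 'n" where
  "starting_point \<iota> b z = (\<chi> i. z + shift_beta \<iota> b $ i)"

definition singular_values :: "real ^ 'n ^ 'n \<Rightarrow> real set" where
  "singular_values A = {sqrt l | l. \<exists>v. v \<noteq> 0 \<and> (transpose A ** A) *v v = l *\<^sub>R v}"

definition spectral_norm :: "real ^ 'n ^ 'n \<Rightarrow> real" where
  "spectral_norm A = Max (singular_values A)"

lemma spectral_norm:
  fixes A :: "real ^ 'n ^ 'n"
  shows "finite (singular_values A)" and "singular_values A \<noteq> {}"
    and "spectral_norm A = onorm ((*v) A)"
proof -
  let ?B = "transpose A ** A" and ?M = "onorm ((*v) A)"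
  define E where "E = {l. \<exists>v. v \<noteq> 0 \<and> ?B *v v = l *\<^sub>R v}"
  have sv: "singular_values A = sqrt ` E" by (auto simp: singular_values_def E_def)
  have bl: "bounded_linear ((*v) A)" by (rule matrix_vector_mul_bounded_linear)
  have le: "norm (A *v x) \<le> ?M * norm x" for x using onorm[OF bl] .
  have M0: "?M \<ge> 0" using onorm_pos_le[OF bl] .
  have B: "(?B *v x) \<bullet> y = (A *v x) \<bullet> (A *v y)" for x y
    by (metis dot_lmul_matrix matrix_vector_mul_assoc transpose_matrix_vector
        inner_commute transpose_transpose)
  have "\<exists>e. \<forall>l\<in>E. e l \<noteq> 0 \<and> ?B *v e l = l *\<^sub>R e l"
    unfolding E_def by (intro bchoice) auto
  then obtain e where e: "\<And>l. l \<in> E \<Longrightarrow> e l \<noteq> 0 \<and> ?B *v e l = l *\<^sub>R e l"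
    by blast
  have orth: "e k \<bullet> e l = 0" if "k \<in> E" "l \<in> E" "k \<noteq> l" for k l
  proof -
    have "k * (e k \<bullet> e l) = l * (e k \<bullet> e l)"
      using B[of "e k" "e l"] B[of "e l" "e k"] e[OF that(1)] e[OF that(2)]
      by (simp add: inner_commute)
    then show ?thesis using that(3) by simp
  qed
  have inj: "inj_on e E"
  proof (rule inj_onI, rule ccontr)
    fix k l assume "k \<in> E" "l \<in> E" "e k = e l" "k \<noteq> l"
    then show False using orth[of k l] e[of l] by simp
  qed
  have "pairwise orthogonal (e ` E)"
    using orth by (auto simp: pairwise_def orthogonal_def)
  then have "independent (e ` E)"
    using e by (intro pairwise_orthogonal_independent) auto
  then have "finite (e ` E)" by (rule independent_imp_finite)
  then have finE: "finite E" using inj by (rule finite_imageD)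
  then show fin: "finite (singular_values A)" by (simp add: sv)
  have upper: "s \<le> ?M" if s: "s \<in> singular_values A" for s
  proof -
    obtain l v where l: "s = sqrt l" "v \<noteq> 0" "?B *v v = l *\<^sub>R v"
      using s by (auto simp: singular_values_def)
    have "l * (norm v)\<^sup>2 = (norm (A *v v))\<^sup>2"
      using B[of v v] l by (simp add: dot_square_norm)
    also have "\<dots> \<le> ?M\<^sup>2 * (norm v)\<^sup>2"
      using power_mono[OF le[of v], of 2] by (simp add: power_mult_distrib)
    finally have "l \<le> ?M\<^sup>2" using l(2) by simp
    then show ?thesis using l(1) M0 real_sqrt_le_mono by fastforce
  qed
  have mem: "?M \<in> singular_values A"
  proof -
    have ne: "sphere (0::real^'n) 1 \<noteq> {}" by simp
    have "continuous_on (sphere 0 1) (\<lambda>x. norm (A *v x))"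
      by (intro continuous_on_norm linear_continuous_on bl)
    from continuous_attains_sup[OF compact_sphere ne this]
    obtain v where v: "norm v = 1" "\<And>x. norm x = 1 \<Longrightarrow> norm (A *v x) \<le> norm (A *v v)"
      by (metis mem_sphere_0)
    have "norm (A *v x) \<le> norm (A *v v) * norm x" for x
    proof (cases "x = 0")
      case False
      have "norm (A *v (x /\<^sub>R norm x)) \<le> norm (A *v v)" by (rule v(2)) (simp add: False)
      then show ?thesis using False
        by (simp add: matrix_vector_mult_scaleR divide_simps mult.commute)
    qed simp
    then have "?M \<le> norm (A *v v)" by (rule onorm_le)
    then have Mv: "norm (A *v v) = ?M" using le[of v] v(1) by simp
    have "(norm (?B *v v))\<^sup>2 = (A *v v) \<bullet> (A *v (?B *v v))"
      using B[of v "?B *v v"] by (simp add: dot_square_norm)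
    also have "\<dots> \<le> ?M * (?M * norm (?B *v v))"
      using norm_cauchy_schwarz[of "A *v v" "A *v (?B *v v)"]
        mult_left_mono[OF le[of "?B *v v"] M0] unfolding Mv by (rule order_trans)
    finally have "norm (?B *v v) * norm (?B *v v) \<le> ?M\<^sup>2 * norm (?B *v v)"
      by (simp add: power2_eq_square mult.assoc)
    then have nB: "norm (?B *v v) \<le> ?M\<^sup>2"
      by (cases "norm (?B *v v) = 0") (auto simp: mult_le_cancel_right)
    have "(norm (?B *v v - ?M\<^sup>2 *\<^sub>R v))\<^sup>2 = (norm (?B *v v))\<^sup>2 - 2 * ?M\<^sup>2 * ((?B *v v) \<bullet> v) + (?M\<^sup>2)\<^sup>2"
      using v(1) unfolding power2_norm_eq_inner inner_diff_left inner_diff_right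
      by (simp add: inner_commute norm_eq_1 power2_eq_square)
    also have "(?B *v v) \<bullet> v = ?M\<^sup>2"
      using B[of v v] Mv by (simp add: dot_square_norm)
    also have "(norm (?B *v v))\<^sup>2 - 2 * ?M\<^sup>2 * ?M\<^sup>2 + (?M\<^sup>2)\<^sup>2 \<le> 0"
      using power_mono[OF nB, of 2] by (simp add: power2_eq_square)
    finally have "?B *v v = ?M\<^sup>2 *\<^sub>R v" by simp
    moreover have "v \<noteq> 0" using v(1) by auto
    ultimately have "sqrt (?M\<^sup>2) \<in> singular_values A"
      unfolding singular_values_def by blast
    then show ?thesis using M0 by simp
  qed
  then show "singular_values A \<noteq> {}" by blast
  show "spectral_norm A = ?M"
    unfolding spectral_norm_def using fin mem upper by (intro Max_eqI) auto
qed

lemma has_derivative_kappa_mult: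
  assumes "assumption_K \<kappa> \<kappa>' c1 L1"
  shows "((\<lambda>x. \<kappa> \<bar>x\<bar> * x) has_real_derivative kappa_d \<kappa> \<kappa>' v) (at v)"
proof -
  have K: "(\<kappa> has_real_derivative \<kappa>' t) (at t within {0..})" if "t \<ge> 0" for t
    using assms that by (simp add: assumption_K_def)
  have pos: "(\<kappa> has_real_derivative \<kappa>' t) (at t)" if "t > 0" for t
  proof -
    have "at t within {0..} = at t"
      using that by (intro at_within_nhd[of _ "{0<..}"]) auto
    then show ?thesis using K[of t] that by simp
  qed
  consider "v > 0" | "v < 0" | "v = 0" by linarith
  then show ?thesis
  proof cases
    case 1
    have "((\<lambda>x. \<kappa> x * x) has_real_derivative kappa_d \<kappa> \<kappa>' v) (at v)"
      using pos[OF 1] 1 by (auto intro!: derivative_eq_intros simp: kappa_d_def)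
    moreover have "\<forall>\<^sub>F x in nhds v. \<kappa> x * x = \<kappa> \<bar>x\<bar> * x"
      using eventually_nhds_in_open[of "{0<..}" v] 1 by (auto elim!: eventually_mono)
    ultimately show ?thesis by (simp add: DERIV_cong_ev)
  next
    case 2
    have "(\<kappa> has_real_derivative \<kappa>' (- v)) (at (- v))" using pos 2 by simp
    then have "((\<lambda>x. \<kappa> (- x)) has_real_derivative \<kappa>' (- v) * - 1) (at v)"
      by (rule DERIV_chain2) (auto intro!: derivative_eq_intros)
    then have "((\<lambda>x. \<kappa> (- x) * x) has_real_derivative kappa_d \<kappa> \<kappa>' v) (at v)"
      using 2 by (auto intro!: derivative_eq_intros simp: kappa_d_def)
    moreover have "\<forall>\<^sub>F x in nhds v. \<kappa> (- x) * x = \<kappa> \<bar>x\<bar> * x"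
      using eventually_nhds_in_open[of "{..<0}" v] 2 by (auto elim!: eventually_mono)
    ultimately show ?thesis by (simp add: DERIV_cong_ev)
  next
    case 3
    have "continuous_on {0..} \<kappa>"
      using K by (intro DERIV_continuous_on) auto
    then have "continuous_on UNIV (\<lambda>x::real. \<kappa> \<bar>x\<bar>)"
      by (rule continuous_on_compose2) (auto intro!: continuous_intros)
    then have "isCont (\<lambda>x::real. \<kappa> \<bar>x\<bar>) 0"
      by (simp add: continuous_on_eq_continuous_at)
    then have "((\<lambda>x. \<kappa> \<bar>x\<bar>) \<longlongrightarrow> \<kappa> 0) (at 0)" by (simp add: isCont_def)
    then have "((\<lambda>h. (\<kappa> \<bar>0 + h\<bar> * (0 + h) - \<kappa> \<bar>0\<bar> * 0) / h) \<longlongrightarrow> \<kappa> 0) (at 0)"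
      by (rule Lim_transform_eventually) (auto simp: eventually_at_filter)
    then have "((\<lambda>x. \<kappa> \<bar>x\<bar> * x) has_real_derivative \<kappa> 0) (at 0)"
      unfolding DERIV_def .
    then show ?thesis using 3 by (simp add: kappa_d_def)
  qed
qed

lemma parareal_jacobian_cyclic:
  fixes \<iota> :: "'n::finite \<Rightarrow> nat" and m T :: real and b :: "nat \<Rightarrow> real"
  assumes "assumption_K \<kappa> \<kappa>' c1 L1"
  defines "c \<equiv> m / (T / real CARD('n))"
  defines "J \<equiv> \<lambda>U. \<chi> i r. (if r = i then c + kappa_d \<kappa> \<kappa>' (U $ i - shift_beta \<iota> b $ i) else 0)
                          - (if r = cyclic_pred \<iota> i then c else 0)"
  shows "(parareal_residual \<iota> \<kappa> m T j b has_derivative (\<lambda>V. J U *v V)) (at U)"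
    and "parareal_jacobian \<iota> \<kappa> m T j b U = J U"
proof -
  have "((\<lambda>U. parareal_residual \<iota> \<kappa> m T j b U $ i) has_derivative (\<lambda>V. (J U *v V) $ i)) (at U)" for i
  proof -
    let ?x = "U $ i - shift_beta \<iota> b $ i"
    have 1: "((\<lambda>x. \<kappa> \<bar>x\<bar> * x) has_derivative (\<lambda>h. kappa_d \<kappa> \<kappa>' ?x * h)) (at ?x)"
      using has_derivative_kappa_mult[OF assms(1)] by (simp add: has_field_derivative_def)
    have 2: "((\<lambda>U. U $ i - shift_beta \<iota> b $ i) has_derivative (\<lambda>V. V $ i)) (at U)"
      by (auto intro!: derivative_eq_intros bounded_linear_imp_has_derivative)
    note 3 = has_derivative_compose[OF 2 1]
    have "((\<lambda>U. c * (U $ i - shift_beta \<iota> b $ i)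
             + \<kappa> \<bar>U $ i - shift_beta \<iota> b $ i\<bar> * (U $ i - shift_beta \<iota> b $ i)
             - c * U $ cyclic_pred \<iota> i - j (real (\<iota> i) * (T / real CARD('n)))) has_derivative
          (\<lambda>V. c * V $ i + kappa_d \<kappa> \<kappa>' ?x * V $ i - c * V $ cyclic_pred \<iota> i - 0)) (at U)"
      by (intro has_derivative_diff has_derivative_add 3 has_derivative_const
            has_derivative_mult_right 2 bounded_linear_imp_has_derivative bounded_linear_vec_nth)
    moreover have "parareal_residual \<iota> \<kappa> m T j b U $ i = c * (U $ i - shift_beta \<iota> b $ i)
             + \<kappa> \<bar>U $ i - shift_beta \<iota> b $ i\<bar> * (U $ i - shift_beta \<iota> b $ i)
             - c * U $ cyclic_pred \<iota> i - j (real (\<iota> i) * (T / real CARD('n)))" for U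
      unfolding parareal_residual_def Let_def c_def by (simp add: distrib_right)
    moreover have "(J U *v V) $ i = c * V $ i + kappa_d \<kappa> \<kappa>' ?x * V $ i - c * V $ cyclic_pred \<iota> i - 0"
      for V
      by (simp add: J_def matrix_vector_mult_def left_diff_distrib sum_subtractf
           if_distrib[of "\<lambda>x. x * _"] distrib_right cong: if_cong)
    ultimately show ?thesis by (simp only:)
  qed
  then show *: "(parareal_residual \<iota> \<kappa> m T j b has_derivative (\<lambda>V. J U *v V)) (at U)"
    by (subst has_derivative_componentwise_within) (auto simp: Basis_vec_def inner_axis)
  show "parareal_jacobian \<iota> \<kappa> m T j b U = J U"
    unfolding parareal_jacobian_def jacobian_def frechet_derivative_at[OF *, symmetric] by simp
qed

end

theory Submission
  imports Defs
begin

text \<open>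
  The Jacobian is \<open>J U = diag (c + kappa_d (U\<^sub>i - \<beta>\<^sub>i)) - c P\<close> with \<open>P\<close> a permutation of the
  coordinates, hence an isometry. At the starting point the diagonal part is the scalar
  \<open>c + kappa_d z\<close>, so the reverse triangle inequality gives
  \<open>\<parallel>J U0 V\<parallel> \<ge> (c + kappa_d z) \<parallel>V\<parallel> - c \<parallel>V\<parallel> = kappa_d z \<parallel>V\<parallel>\<close>: the contribution of \<open>c\<close> cancels.
  Strong monotonicity of \<open>t \<mapsto> \<kappa> t * t\<close>, whose derivative is \<open>kappa_d\<close>, yields \<open>kappa_d z \<ge> c1\<close>.
  Thus \<open>J U0\<close> is invertible with inverse of norm at most \<open>1 / c1\<close>
  (\<open>parareal_jacobian_starting_point_lower_bound\<close>, \<open>invertible_if_bounded_below\<close>).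

  In \<open>J U - J U0\<close> the shift cancels, and what remains is a diagonal matrix with entries
  \<open>kappa_d (U\<^sub>i - \<beta>\<^sub>i) - kappa_d z\<close>. Since \<open>z = U0\<^sub>i - \<beta>\<^sub>i\<close>, each entry is at most
  \<open>L2 |U\<^sub>i - U0\<^sub>i| \<le> L2 \<parallel>U - U0\<parallel>\<close> in modulus. Multiplying the two bounds gives \<open>\<delta>0 = L2 / c1\<close>.

  The constant \<open>sup |\<kappa>'| + L1\<close> comes from splitting \<open>kappa_d x\<close> into \<open>\<kappa>' |x| * |x|\<close>, which is
  Lipschitz by assumption, and \<open>\<kappa> |x|\<close>, which is handled by the mean value theorem; the supremum
  is finite because \<open>\<kappa>'\<close> is continuous and tends to \<open>0\<close>.
\<close>

section \<open>Bounds for kappa and its differential\<close>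

text \<open>
  The function \<open>\<kappa> t * t - c1 * t\<close> is nondecreasing on the half line, so its derivative is
  nonnegative at interior points; at \<open>0\<close> the claim is the lower bound on \<open>\<kappa>\<close>.
\<close>

lemma kappa_d_ge:
  assumes K: "assumption_K \<kappa> \<kappa>' c1 L1"
  shows "c1 \<le> kappa_d \<kappa> \<kappa>' x"
proof (cases "x = 0")
  case True
  then show ?thesis using K by (simp add: kappa_d_def assumption_K_def)
next
  case False
  let ?h = "\<lambda>t. \<kappa> \<bar>t\<bar> * t - c1 * t"
  have "mono_on {0..} ?h"
  proof (rule mono_onI)
    fix s t :: real
    assume st: "s \<in> {0..}" "t \<in> {0..}" "s \<le> t"
    have "(\<kappa> t * t - \<kappa> s * s) * (t - s) \<ge> c1 * (t - s) * (t - s)"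
      using K st by (simp add: assumption_K_def power2_eq_square mult.assoc)
    then have "t = s \<or> c1 * (t - s) \<le> \<kappa> t * t - \<kappa> s * s"
      using st(3) by (auto simp: mult_le_cancel_right)
    then show "?h s \<le> ?h t" using st by (auto simp: algebra_simps)
  qed
  moreover have "(?h has_real_derivative kappa_d \<kappa> \<kappa>' \<bar>x\<bar> - c1) (at \<bar>x\<bar>)"
    by (rule DERIV_diff[OF has_derivative_kappa_mult[OF K] DERIV_cmult_Id])
  moreover have "\<bar>x\<bar> \<in> interior {0..}" using False by simp
  ultimately have "0 \<le> kappa_d \<kappa> \<kappa>' \<bar>x\<bar> - c1"
    by (rule mono_on_imp_deriv_nonneg)
  then show ?thesis by (simp add: kappa_d_def)
qed

lemma bounded_image_atLeast_if_continuous_tendsto: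
  fixes f :: "real \<Rightarrow> 'a::real_normed_vector"
  assumes cont: "continuous_on {a..} f" and lim: "(f \<longlongrightarrow> l) at_top"
  shows "bounded (f ` {a..})"
proof -
  have "\<forall>\<^sub>F t in at_top. dist (f t) l < 1" using lim by (rule tendstoD) simp
  then obtain B where B: "\<And>t. t \<ge> B \<Longrightarrow> dist (f t) l < 1"
    by (auto simp: eventually_at_top_linorder)
  have "compact (f ` {a..B})"
    by (intro compact_continuous_image continuous_on_subset[OF cont]) auto
  then have "bounded (f ` {a..B} \<union> ball l 1)"
    by (simp add: compact_imp_bounded)
  moreover have "f ` {a..} \<subseteq> f ` {a..B} \<union> ball l 1"
  proof
    fix y assume "y \<in> f ` {a..}"
    then obtain t where "t \<ge> a" "y = f t" by auto
    then show "y \<in> f ` {a..B} \<union> ball l 1"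
      using B[of t] by (cases "t \<le> B") (auto simp: dist_commute)
  qed
  ultimately show ?thesis by (rule bounded_subset)
qed

lemma bdd_above_abs_kappa':
  assumes "assumption_K \<kappa> \<kappa>' c1 L1"
  shows "bdd_above ((\<lambda>t. \<bar>\<kappa>' t\<bar>) ` {0..})"
proof -
  have "bounded (\<kappa>' ` {0..})"
    using assms by (intro bounded_image_atLeast_if_continuous_tendsto[where l=0])
      (auto simp: assumption_K_def)
  then have "bdd_above (norm ` \<kappa>' ` {0..})" by (simp only: bdd_above_norm)
  then show ?thesis by (simp only: image_image real_norm_def)
qed

lemma lipschitz_on_kappa_d:
  assumes K: "assumption_K \<kappa> \<kappa>' c1 L1"
  shows "((SUP t\<in>{0..}. \<bar>\<kappa>' t\<bar>) + L1)-lipschitz_on UNIV (kappa_d \<kappa> \<kappa>')"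
proof -
  let ?M = "SUP t\<in>{0..}. \<bar>\<kappa>' t\<bar>"
  have le: "\<bar>\<kappa>' t\<bar> \<le> ?M" if "t \<ge> 0" for t
    using that by (intro cSUP_upper bdd_above_abs_kappa'[OF K]) auto
  have "?M-lipschitz_on {0..} \<kappa>"
  proof (rule lipschitz_onI)
    show "0 \<le> ?M" using le[of 0] by linarith
    show "dist (\<kappa> s) (\<kappa> t) \<le> ?M * dist s t" if "s \<in> {0..}" "t \<in> {0..}" for s t
      unfolding dist_norm
      by (rule field_differentiable_bound[of "{0..}" \<kappa> \<kappa>'])
        (use K le that in \<open>auto simp: assumption_K_def\<close>)
  qed
  moreover have "L1-lipschitz_on {0..} (\<lambda>t. \<kappa>' t * t)"
    using K by (simp add: assumption_K_def)
  ultimately have sum: "(L1 + ?M)-lipschitz_on {0..} (\<lambda>t. \<kappa>' t * t + \<kappa> t)"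
    by (intro lipschitz_on_add)
  have abs: "1-lipschitz_on UNIV (abs :: real \<Rightarrow> real)"
    by (rule lipschitz_onI) (auto simp: dist_real_def)
  have "((L1 + ?M) * 1)-lipschitz_on UNIV (\<lambda>x. \<kappa>' \<bar>x\<bar> * \<bar>x\<bar> + \<kappa> \<bar>x\<bar>)"
    by (rule lipschitz_on_compose2[OF abs]) (rule lipschitz_on_subset[OF sum], auto)
  then show ?thesis by (simp add: kappa_d_def[abs_def] add.commute)
qed

section \<open>Matrices bounded below and coordinate permutations\<close>

lemma invertible_if_bounded_below:
  fixes A :: "real ^ 'n ^ 'n"
  assumes a: "a > 0" and below: "\<And>V. a * norm V \<le> norm (A *v V)"
  shows "invertible A" and "norm (matrix_inv A *v W) \<le> norm W / a"
proof -
  have "V = 0" if "A *v V = 0" for V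
    using below[of V] that a by (simp add: mult_le_0_iff)
  then show inv: "invertible A"
    by (simp add: invertible_left_inverse matrix_left_invertible_ker)
  have "A ** matrix_inv A = mat 1"
    using someI_ex[OF inv[unfolded invertible_def]] by (simp add: matrix_inv_def)
  then have "A *v (matrix_inv A *v W) = W"
    by (simp add: matrix_vector_mul_assoc)
  then show "norm (matrix_inv A *v W) \<le> norm W / a"
    using below[of "matrix_inv A *v W"] a by (simp add: field_simps)
qed

lemma norm_permute_coordinates:
  fixes V :: "real ^ 'n"
  assumes "bij p"
  shows "norm (\<chi> i. V $ p i) = norm V"
  using sum.reindex_bij_betw[OF assms, of "\<lambda>i. (V $ i)\<^sup>2"]
  by (simp add: norm_vec_def L2_set_def)

lemma bij_cyclic_pred:
  fixes \<iota> :: "'n::finite \<Rightarrow> nat"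
  assumes bij: "bij_betw \<iota> UNIV {0..<CARD('n)}"
  shows "bij (cyclic_pred \<iota>)"
proof -
  let ?q = "\<lambda>i. if \<iota> i = 0 then CARD('n) - 1 else \<iota> i - 1"
  have lt: "\<iota> i < CARD('n)" for i using bij_betwE[OF bij] by auto
  have inj: "\<iota> i = \<iota> k \<Longrightarrow> i = k" for i k
    using bij by (auto simp: bij_betw_def inj_on_def)
  have q: "\<iota> (cyclic_pred \<iota> i) = ?q i" for i
  proof -
    have "?q i \<in> {0..<CARD('n)}" using lt[of i] by auto
    then show ?thesis
      unfolding cyclic_pred_def using bij by (intro f_inv_into_f) (simp add: bij_betw_def)
  qed
  have "inj (cyclic_pred \<iota>)"
  proof (rule injI)
    fix i k assume "cyclic_pred \<iota> i = cyclic_pred \<iota> k"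
    then have "?q i = ?q k" using q[of i] q[of k] by simp
    then have "\<iota> i = \<iota> k" using lt[of i] lt[of k] by (auto split: if_splits)
    then show "i = k" by (rule inj)
  qed
  then show ?thesis by (simp add: bij_def finite_UNIV_inj_surj)
qed

section \<open>The Parareal Jacobian\<close>

lemma parareal_jacobian_mult_nth:
  fixes \<iota> :: "'n::finite \<Rightarrow> nat" and m T :: real
  assumes "assumption_K \<kappa> \<kappa>' c1 L1"
  defines "c \<equiv> m / (T / real CARD('n))"
  shows "(parareal_jacobian \<iota> \<kappa> m T j b U *v V) $ i =
    (c + kappa_d \<kappa> \<kappa>' (U $ i - shift_beta \<iota> b $ i)) * V $ i - c * V $ cyclic_pred \<iota> i"
  unfolding parareal_jacobian_cyclic(2)[OF assms(1)] c_def
  by (simp add: matrix_vector_mult_def left_diff_distrib sum_subtractf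
      if_distrib[of "\<lambda>x. x * _"] cong: if_cong)

text \<open>
  The scalar diagonal dominates the cyclic shift by \<open>kappa_d z\<close>, uniformly in the time step,
  because the shift is an isometry.
\<close>

lemma parareal_jacobian_starting_point_lower_bound:
  fixes \<iota> :: "'n::finite \<Rightarrow> nat"
  assumes K: "assumption_K \<kappa> \<kappa>' c1 L1" and "m \<ge> 0" and "T > 0"
    and bij: "bij_betw \<iota> UNIV {0..<CARD('n)}"
  shows "c1 * norm V \<le> norm (parareal_jacobian \<iota> \<kappa> m T j b (starting_point \<iota> b z) *v V)"
proof -
  define c where "c = m / (T / real CARD('n))"
  have c: "c \<ge> 0" using assms by (simp add: c_def)
  let ?d = "kappa_d \<kappa> \<kappa>' z"
  let ?P = "\<chi> i. V $ cyclic_pred \<iota> i"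
  have d: "c1 \<le> ?d" "0 \<le> ?d"
    using kappa_d_ge[OF K, of z] K by (auto simp: assumption_K_def)
  have "c1 * norm V \<le> ?d * norm V" using d by (simp add: mult_right_mono)
  also have "\<dots> = norm ((c + ?d) *\<^sub>R V) - norm (c *\<^sub>R ?P)"
    using c d norm_permute_coordinates[OF bij_cyclic_pred[OF bij], of V]
    by (simp add: left_diff_distrib[symmetric])
  also have "\<dots> \<le> norm ((c + ?d) *\<^sub>R V - c *\<^sub>R ?P)" by (rule norm_triangle_ineq2)
  also have "(c + ?d) *\<^sub>R V - c *\<^sub>R ?P =
      parareal_jacobian \<iota> \<kappa> m T j b (starting_point \<iota> b z) *v V"
    by (simp add: vec_eq_iff parareal_jacobian_mult_nth[OF K] starting_point_def c_def)
  finally show ?thesis .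
qed

lemma parareal_jacobian_diff_bound:
  fixes \<iota> :: "'n::finite \<Rightarrow> nat"
  assumes K: "assumption_K \<kappa> \<kappa>' c1 L1" and lip: "L2-lipschitz_on UNIV (kappa_d \<kappa> \<kappa>')"
  shows "norm ((parareal_jacobian \<iota> \<kappa> m T j b U - parareal_jacobian \<iota> \<kappa> m T j b W) *v V)
    \<le> L2 * norm (U - W) * norm V"
proof -
  let ?A = "parareal_jacobian \<iota> \<kappa> m T j b U - parareal_jacobian \<iota> \<kappa> m T j b W"
  let ?\<beta> = "shift_beta \<iota> b"
  let ?r = "L2 * norm (U - W)"
  have L2: "0 \<le> L2" using lip by (rule lipschitz_on_nonneg)
  have "norm ((?A *v V) $ i) \<le> norm ((?r *\<^sub>R V) $ i)" for i
  proof -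
    have "\<bar>kappa_d \<kappa> \<kappa>' (U $ i - ?\<beta> $ i) - kappa_d \<kappa> \<kappa>' (W $ i - ?\<beta> $ i)\<bar>
        \<le> L2 * \<bar>(U - W) $ i\<bar>"
      using lipschitz_onD[OF lip, of "U $ i - ?\<beta> $ i" "W $ i - ?\<beta> $ i"]
      by (simp add: dist_real_def)
    also have "\<dots> \<le> ?r" using L2 component_le_norm_cart[of "U - W" i] by (rule mult_left_mono[rotated])
    finally have entry: "\<bar>kappa_d \<kappa> \<kappa>' (U $ i - ?\<beta> $ i) - kappa_d \<kappa> \<kappa>' (W $ i - ?\<beta> $ i)\<bar> \<le> ?r" .
    have "(?A *v V) $ i =
        (kappa_d \<kappa> \<kappa>' (U $ i - ?\<beta> $ i) - kappa_d \<kappa> \<kappa>' (W $ i - ?\<beta> $ i)) * V $ i"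
      by (simp add: matrix_vector_mult_diff_rdistrib parareal_jacobian_mult_nth[OF K] algebra_simps)
    then show ?thesis
      using mult_right_mono[OF entry, of "\<bar>V $ i\<bar>"] L2 by (simp add: abs_mult)
  qed
  then have "norm (?A *v V) \<le> norm (?r *\<^sub>R V)" by (rule norm_le_componentwise_cart)
  then show ?thesis using L2 by simp
qed

theorem theorem5p6:
  fixes \<kappa> \<kappa>' j :: "real \<Rightarrow> real" and c1 L1 L2 m T z :: real and b :: "nat \<Rightarrow> real"
    and \<iota> :: "'n::finite \<Rightarrow> nat" and D :: "(real ^ 'n) set"
  assumes "assumption_K \<kappa> \<kappa>' c1 L1"
    and "m \<ge> 0" and "T > 0"
    and "\<forall>t. j (t + T) = j t"
    and "bij_betw \<iota> UNIV {0..<CARD('n)}"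
    and "open D" and "convex D" and "starting_point \<iota> b z \<in> D"
    and "L2-lipschitz_on UNIV (kappa_d \<kappa> \<kappa>')"
  shows
    "let J = parareal_jacobian \<iota> \<kappa> m T j b; U0 = starting_point \<iota> b z; \<delta>0 = L2 / c1 in
       invertible (J U0) \<and>
       (\<forall>U\<in>D. spectral_norm (matrix_inv (J U0) ** (J U - J U0)) \<le> \<delta>0 * norm (U - U0)) \<and>
       bdd_above ((\<lambda>t. \<bar>\<kappa>' t\<bar>) ` {0..}) \<and>
       ((SUP t\<in>{0..}. \<bar>\<kappa>' t\<bar>) + L1)-lipschitz_on UNIV (kappa_d \<kappa> \<kappa>')"
proof -
  let ?J = "parareal_jacobian \<iota> \<kappa> m T j b"
  let ?U0 = "starting_point \<iota> b z"
  have c1: "c1 > 0" using assms(1) by (simp add: assumption_K_def)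
  note inverse_bounds = invertible_if_bounded_below[OF c1
      parareal_jacobian_starting_point_lower_bound[OF assms(1,2,3,5), where j=j and b=b and z=z]]
  have "spectral_norm (matrix_inv (?J ?U0) ** (?J U - ?J ?U0)) \<le> L2 / c1 * norm (U - ?U0)" for U
    unfolding spectral_norm(3)
  proof (rule onorm_le)
    fix V
    let ?W = "(?J U - ?J ?U0) *v V"
    have "norm ((matrix_inv (?J ?U0) ** (?J U - ?J ?U0)) *v V) \<le> norm ?W / c1"
      using inverse_bounds(2)[of ?W] by (simp add: matrix_vector_mul_assoc)
    also have "\<dots> \<le> L2 * norm (U - ?U0) * norm V / c1"
      using c1 by (intro divide_right_mono parareal_jacobian_diff_bound[OF assms(1,9)]) simp
    finally show "norm ((matrix_inv (?J ?U0) ** (?J U - ?J ?U0)) *v V)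
        \<le> L2 / c1 * norm (U - ?U0) * norm V"
      by simp
  qed
  then show ?thesis
    using inverse_bounds(1) bdd_above_abs_kappa'[OF assms(1)] lipschitz_on_kappa_d[OF assms(1)]
    by (simp add: Let_def)
qed

end
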